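(* Let $I$ be a nonempty open interval with $\inf I=0$ and let $E\colon I\times I\to\mathbb{R}$ be a normalizable semideviation with normalization $E^*$. Define, for $x\in\mathbb{R}_+$, $$\underline{h}_E(x):=\liminf_{t\to0}\frac{E^*(xt,t)}t,\qquad\overline{h}_E(x):=\limsup_{t\to0}\frac{E^*(xt,t)}t .$$ Assume that, for all $x\in\mathbb{R}_+$, $-\infty<\underline{h}_E(x)\le\overline{h}_E(x)<+\infty$ and $$\operatorname{sign}(\underline{h}_E(x))=\operatorname{sign}(\overline{h}_E(x))=\operatorname{sign}(x-1).$$ Then $$\underline{\underline{\mathcal{E}}}_{\underline{h}_E}\le\big(\overline{\mathcal{D}}_E\big)_\#\qquad\text{and}\qquad\big(\underline{\mathcal{D}}_E\big)^\#\le\overline{\overline{\mathcal{E}}}_{\overline{h}_E}$$ on $\bigcup_{n=1}^\infty\mathbb{R}_+^n\times W_n(\mathbb{R})$.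
   Context: $\mathbb{R}_+=(0,\infty)$; limits $t\to0$ are over positive $t$. For $n\in\mathbb{N}$, $W_n(\mathbb{R})=\{(\lambda_1,\dots,\lambda_n)\in\mathbb{R}^n\mid\lambda_i\ge0\ \forall i,\ \lambda_1+\dots+\lambda_n>0\}$. For an interval $I$, a function $E\colon I\times I\to\mathbb{R}$ is a semideviation if for all distinct $x,y\in I$ the sign of $E(x,y)$ equals the sign of $x-y$. For $(x,\lambda)\in I^n\times W_n(\mathbb{R})$ let $e(y)=\lambda_1E(x_1,y)+\cdots+\lambda_nE(x_n,y)$, $y\in I$, and define $\underline{\underline{\mathcal{D}}}_E(x,\lambda)=\inf\{y\in I\mid e(y)\le0\}$, $\ \overline{\overline{\mathcal{D}}}_E(x,\lambda)=\sup\{y\in I\mid e(y)\ge0\}$, $\underline{\mathcal{D}}_E(x,\lambda)=\inf\{y\in I\mid e(y)<0\}$, $\ \overline{\mathcal{D}}_E(x,\lambda)=\sup\{y\in I\mid e(y)>0\}$. A semideviation $E\colon I\times I\to\mathbb{R}$ is normalizable if (a) for all $x\in I$ the function $y\mapsto E(x,y)$ is continuous on $I$; (b) for all $x\in I$ the function $y\mapsto E(x,y)$ is differentiable at $y=x$ (with derivative $\partial_2E(x,x)$); (c) $x\mapsto\partial_2E(x,x)$ is strictly negative and continuous on $I$. Its normalization is $E^*(x,y)=\dfrac{E(x,y)}{-\partial_2E(y,y)}$. For a function $f\colon\mathbb{R}_+\to\mathbb{R}$ with $\operatorname{sign}(f(x))=\operatorname{sign}(x-1)$ for all $0<x\ne1$,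 the function $E_f(x,y):=f(x/y)$ is a semideviation on $\mathbb{R}_+$, and $\underline{\underline{\mathcal{E}}}_f:=\underline{\underline{\mathcal{D}}}_{E_f}$, $\overline{\overline{\mathcal{E}}}_f:=\overline{\overline{\mathcal{D}}}_{E_f}$. For a weighted mean $\mathcal{M}\colon\bigcup_nI^n\times W_n(\mathbb{R})\to I$ with $\inf I=0$, put, for $(x,\lambda)\in\mathbb{R}_+^n\times W_n(\mathbb{R})$, $\mathcal{M}_\#(x,\lambda)=\liminf_{t\to0}\frac1t\mathcal{M}(tx,\lambda)$ and $\mathcal{M}^\#(x,\lambda)=\limsup_{t\to0}\frac1t\mathcal{M}(tx,\lambda)$. *)

theory Defs
  imports "HOL-Analysis.Analysis"
begin

text \<open>
  Conventions.  An element of \<open>I\<^sup>n\<close>, and a weight vector of length \<open>n\<close>, is a function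
  \<open>nat \<Rightarrow> real\<close> of which only the values at \<open>1, \<dots>, n\<close> are relevant.  A function on \<open>I \<times> I\<close>
  is a total function of two real arguments whose values off \<open>I \<times> I\<close> are never constrained.
\<close>

definition weights :: "nat \<Rightarrow> (nat \<Rightarrow> real) set" where
  "weights n = {l. (\<forall>i\<in>{1..n}. 0 \<le> l i) \<and> 0 < (\<Sum>i=1..n. l i)}"

text \<open>Nothing is required of the values on the diagonal.\<close>

definition semideviation :: "real set \<Rightarrow> (real \<Rightarrow> real \<Rightarrow> real) \<Rightarrow> bool" where
  "semideviation I E \<longleftrightarrow> (\<forall>x\<in>I. \<forall>y\<in>I. x \<noteq> y \<longrightarrow> sgn (E x y) = sgn (x - y))"

definition dev_sum ::
  "(real \<Rightarrow> real \<Rightarrow> real) \<Rightarrow> nat \<Rightarrow> (nat \<Rightarrow> real) \<Rightarrow> (nat \<Rightarrow> real) \<Rightarrow> real \<Rightarrow> real" where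
  "dev_sum E n x l y = (\<Sum>i=1..n. l i * E (x i) y)"

text \<open>
  The four semideviation means are used for open intervals \<open>I\<close>, \<open>x \<in> I\<^sup>n\<close> and \<open>l \<in> weights n\<close>.
  Then \<open>dev_sum E n x l\<close> is positive on \<open>I\<close> below the smallest entry of \<open>x\<close> and negative on \<open>I\<close>
  above the largest one, so every infimum (supremum) below is one of a nonempty set of reals
  that is bounded below (above).  The suffixes tell whether the inequality is weak or strict:
  \<open>_w\<close> corresponds to the doubly, \<open>_s\<close> to the singly underlined (overlined) mean.
\<close>

definition lower_mean_w ::
  "real set \<Rightarrow> (real \<Rightarrow> real \<Rightarrow> real) \<Rightarrow> nat \<Rightarrow> (nat \<Rightarrow> real) \<Rightarrow> (nat \<Rightarrow> real) \<Rightarrow> real" where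
  "lower_mean_w I E n x l = Inf {y \<in> I. dev_sum E n x l y \<le> 0}"

definition upper_mean_w ::
  "real set \<Rightarrow> (real \<Rightarrow> real \<Rightarrow> real) \<Rightarrow> nat \<Rightarrow> (nat \<Rightarrow> real) \<Rightarrow> (nat \<Rightarrow> real) \<Rightarrow> real" where
  "upper_mean_w I E n x l = Sup {y \<in> I. dev_sum E n x l y \<ge> 0}"

definition lower_mean_s ::
  "real set \<Rightarrow> (real \<Rightarrow> real \<Rightarrow> real) \<Rightarrow> nat \<Rightarrow> (nat \<Rightarrow> real) \<Rightarrow> (nat \<Rightarrow> real) \<Rightarrow> real" where
  "lower_mean_s I E n x l = Inf {y \<in> I. dev_sum E n x l y < 0}"

definition upper_mean_s ::
  "real set \<Rightarrow> (real \<Rightarrow> real \<Rightarrow> real) \<Rightarrow> nat \<Rightarrow> (nat \<Rightarrow> real) \<Rightarrow> (nat \<Rightarrow> real) \<Rightarrow> real" where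
  "upper_mean_s I E n x l = Sup {y \<in> I. dev_sum E n x l y > 0}"

text \<open>
  \<open>diag_deriv E x\<close> is the partial derivative of \<open>E\<close> in its second variable at \<open>(x, x)\<close>.
  It is the two-sided derivative, which is the derivative within \<open>I\<close> because \<open>I\<close> is open.
\<close>

definition diag_deriv :: "(real \<Rightarrow> real \<Rightarrow> real) \<Rightarrow> real \<Rightarrow> real" where
  "diag_deriv E x = deriv (\<lambda>y. E x y) x"

definition normalizable :: "real set \<Rightarrow> (real \<Rightarrow> real \<Rightarrow> real) \<Rightarrow> bool" where
  "normalizable I E \<longleftrightarrow>
     (\<forall>x\<in>I. continuous_on I (\<lambda>y. E x y)) \<and>
     (\<forall>x\<in>I. (\<lambda>y. E x y) differentiable (at x)) \<and>
     (\<forall>x\<in>I. diag_deriv E x < 0) \<and>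
     continuous_on I (diag_deriv E)"

definition normalization :: "(real \<Rightarrow> real \<Rightarrow> real) \<Rightarrow> real \<Rightarrow> real \<Rightarrow> real" where
  "normalization E x y = E x y / (- diag_deriv E y)"

definition hom_dev :: "(real \<Rightarrow> real) \<Rightarrow> real \<Rightarrow> real \<Rightarrow> real" where
  "hom_dev f x y = f (x / y)"

definition hom_lower_mean_w ::
  "(real \<Rightarrow> real) \<Rightarrow> nat \<Rightarrow> (nat \<Rightarrow> real) \<Rightarrow> (nat \<Rightarrow> real) \<Rightarrow> real" where
  "hom_lower_mean_w f = lower_mean_w {0<..} (hom_dev f)"

definition hom_upper_mean_w ::
  "(real \<Rightarrow> real) \<Rightarrow> nat \<Rightarrow> (nat \<Rightarrow> real) \<Rightarrow> (nat \<Rightarrow> real) \<Rightarrow> real" where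
  "hom_upper_mean_w f = upper_mean_w {0<..} (hom_dev f)"

text \<open>
  Below, the expressions under the limits make sense only when the points \<open>t\<close>, \<open>x * t\<close>,
  respectively the entries of \<open>t x\<close>, lie in \<open>I\<close>.  For an interval with infimum \<open>0\<close> not
  containing \<open>0\<close> this holds for all sufficiently small \<open>t > 0\<close>, hence eventually in
  \<open>at_right 0\<close>.  The limits are taken in the extended reals.
\<close>

definition lower_hash ::
  "(nat \<Rightarrow> (nat \<Rightarrow> real) \<Rightarrow> (nat \<Rightarrow> real) \<Rightarrow> real) \<Rightarrow> nat \<Rightarrow> (nat \<Rightarrow> real) \<Rightarrow> (nat \<Rightarrow> real) \<Rightarrow> ereal" where
  "lower_hash M n x l = Liminf (at_right (0::real)) (\<lambda>t. ereal (1 / t * M n (\<lambda>i. t * x i) l))"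

definition upper_hash ::
  "(nat \<Rightarrow> (nat \<Rightarrow> real) \<Rightarrow> (nat \<Rightarrow> real) \<Rightarrow> real) \<Rightarrow> nat \<Rightarrow> (nat \<Rightarrow> real) \<Rightarrow> (nat \<Rightarrow> real) \<Rightarrow> ereal" where
  "upper_hash M n x l = Limsup (at_right (0::real)) (\<lambda>t. ereal (1 / t * M n (\<lambda>i. t * x i) l))"

definition lower_h :: "(real \<Rightarrow> real \<Rightarrow> real) \<Rightarrow> real \<Rightarrow> ereal" where
  "lower_h E x = Liminf (at_right (0::real)) (\<lambda>t. ereal (normalization E (x * t) t / t))"

definition upper_h :: "(real \<Rightarrow> real \<Rightarrow> real) \<Rightarrow> real \<Rightarrow> ereal" where
  "upper_h E x = Limsup (at_right (0::real)) (\<lambda>t. ereal (normalization E (x * t) t / t))"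

end

theory Submission
  imports Defs
begin

text \<open>
  If \<open>y > 0\<close> satisfies \<open>\<Sum>i. l i * h (x i / y) > 0\<close> for the lower limit \<open>h\<close>, then by
  superadditivity of the lower limit, applied along \<open>s = t * y\<close>, the sum
  \<open>\<Sum>i. l i * E\<^sup>* (t * x i) (t * y)\<close> is positive for all small \<open>t > 0\<close>.  Division by
  \<open>- diag_deriv E (t * y) > 0\<close> does not affect the sign, so \<open>t * y\<close> is at most the upper mean of
  the \<open>t * x i\<close>.  Every positive \<open>y\<close> below the homogeneous lower mean of \<open>h\<close> qualifies.  The other
  inequality is dual.
\<close>

section \<open>Signs of weighted deviation sums\<close>

lemma weighted_sum_pos:
  assumes "l \<in> weights n" "\<And>i. i \<in> {1..n} \<Longrightarrow> 0 < a i"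
  shows "0 < (\<Sum>i=1..n. l i * a i)"
proof -
  have l: "\<And>i. i \<in> {1..n} \<Longrightarrow> 0 \<le> l i" "0 < (\<Sum>i=1..n. l i)"
    using assms(1) by (auto simp: weights_def)
  then obtain i where i: "i \<in> {1..n}" "0 < l i"
    by (meson not_le sum_nonpos)
  show ?thesis
  proof (rule sum_pos2[OF _ i(1)])
    show "0 < l i * a i" using i assms(2) by simp
    show "0 \<le> l j * a j" if "j \<in> {1..n}" for j
      using l(1)[OF that] assms(2)[OF that] by simp
  qed simp
qed

lemma dev_sum_pos:
  assumes "semideviation I E" "l \<in> weights n" "y \<in> I"
    and "\<And>i. i \<in> {1..n} \<Longrightarrow> x i \<in> I \<and> y < x i"
  shows "0 < dev_sum E n x l y"
  unfolding dev_sum_def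
proof (rule weighted_sum_pos[OF assms(2)])
  fix i assume "i \<in> {1..n}"
  then have "x i \<in> I" "y < x i" using assms(4) by auto
  then have "sgn (E (x i) y) = 1"
    using assms(1,3) unfolding semideviation_def by fastforce
  then show "0 < E (x i) y" by (simp add: sgn_1_pos)
qed

lemma dev_sum_neg:
  assumes "semideviation I E" "l \<in> weights n" "y \<in> I"
    and "\<And>i. i \<in> {1..n} \<Longrightarrow> x i \<in> I \<and> x i < y"
  shows "dev_sum E n x l y < 0"
proof -
  have "0 < (\<Sum>i=1..n. l i * - E (x i) y)"
  proof (rule weighted_sum_pos[OF assms(2)])
    fix i assume "i \<in> {1..n}"
    then have "x i \<in> I" "x i < y" using assms(4) by auto
    then have "sgn (E (x i) y) = -1"
      using assms(1,3) unfolding semideviation_def by fastforce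
    then show "0 < - E (x i) y" by (simp add: sgn_1_neg)
  qed
  then show ?thesis by (simp add: dev_sum_def sum_negf)
qed

text \<open>Beyond the largest entry every deviation is negative, hence so is the sum. The case n =
  0, where \<open>Max\<close> is unspecified, cannot occur because \<open>weights 0\<close> is
  empty.\<close>

lemma bdd_above_dev_sum_nonneg:
  assumes "semideviation I E" "l \<in> weights n" "\<And>i. i \<in> {1..n} \<Longrightarrow> x i \<in> I"
  shows "bdd_above {y \<in> I. dev_sum E n x l y \<ge> 0}"
proof (rule bdd_aboveI)
  fix y assume y: "y \<in> {y \<in> I. dev_sum E n x l y \<ge> 0}"
  show "y \<le> Max (x ` {1..n})"
  proof (rule ccontr)
    assume "\<not> y \<le> Max (x ` {1..n})"
    moreover have "x i \<le> Max (x ` {1..n})" if "i \<in> {1..n}" for i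
      using that by (intro Max_ge) auto
    ultimately have less: "x i < y" if "i \<in> {1..n}" for i
      using that by (meson le_less_trans not_le)
    have "dev_sum E n x l y < 0"
      by (rule dev_sum_neg[OF assms(1,2)]) (use y less assms(3) in auto)
    then show False using y by simp
  qed
qed

lemma semideviation_hom_dev:
  assumes "\<And>u. 0 < u \<Longrightarrow> sgn (f u) = sgn (u - 1)"
  shows "semideviation {0<..} (hom_dev f)"
proof -
  have "sgn (x / y - 1) = sgn (x - y)" if "0 < x" "0 < y" for x y :: real
    using that by (auto simp: sgn_if field_simps)
  then show ?thesis
    by (auto simp: semideviation_def hom_dev_def assms)
qed

text \<open>Supplies one positive real at which the sum is positive. It settles nonpositive bounds
  in the lower estimate and makes the homogeneous upper mean positive.\<close>

lemma hom_dev_sum_pos_witness: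
  assumes "semideviation {0<..} (hom_dev f)" "l \<in> weights n" "\<And>i. i \<in> {1..n} \<Longrightarrow> 0 < x i"
  obtains y where "0 < y" "0 < dev_sum (hom_dev f) n x l y"
proof -
  \<comment> \<open>Inserting 1 keeps the set nonempty for every n; halving puts y strictly below
    all entries.\<close>
  define y where "y = Min (insert 1 (x ` {1..n})) / 2"
  have min: "0 < Min (insert 1 (x ` {1..n}))"
    by (subst Min_gr_iff) (use assms(3) in auto)
  have y: "0 < y" using min by (simp add: y_def)
  have "y < x i" if "i \<in> {1..n}" for i
  proof -
    have "Min (insert 1 (x ` {1..n})) \<le> x i" using that by (intro Min_le) auto
    then show ?thesis using min unfolding y_def by linarith
  qed
  then have "0 < dev_sum (hom_dev f) n x l y"
    by (intro dev_sum_pos[OF assms(1,2)]) (use y assms(3) in auto)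
  with y show ?thesis by (rule that)
qed

section \<open>Signs of weighted sums near a limit\<close>

lemma eventually_weighted_sum_pos:
  fixes h :: "nat \<Rightarrow> real" and g :: "nat \<Rightarrow> 'a \<Rightarrow> real"
  assumes l: "l \<in> weights n"
    and h: "\<And>i. i \<in> {1..n} \<Longrightarrow> ereal (h i) \<le> Liminf F (\<lambda>s. ereal (g i s))"
    and pos: "0 < (\<Sum>i=1..n. l i * h i)"
  shows "eventually (\<lambda>s. 0 < (\<Sum>i=1..n. l i * g i s)) F"
proof -
  have l0: "\<And>i. i \<in> {1..n} \<Longrightarrow> 0 \<le> l i" and L: "0 < (\<Sum>i=1..n. l i)"
    using l by (auto simp: weights_def)
  \<comment> \<open>Half the weighted average of h: lowering every h i by e only halves the weighted
    sum, while each g i s eventually exceeds h i - e strictly.\<close>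
  define e where "e = (\<Sum>i=1..n. l i * h i) / (2 * (\<Sum>i=1..n. l i))"
  have e: "0 < e" using pos L by (simp add: e_def)
  have "(\<Sum>i=1..n. l i * (h i - e)) = (\<Sum>i=1..n. l i * h i) - (\<Sum>i=1..n. l i) * e"
    by (simp add: right_diff_distrib sum_subtractf sum_distrib_right)
  also have "\<dots> = (\<Sum>i=1..n. l i * h i) / 2"
    using L by (simp add: e_def field_simps)
  finally have half: "0 < (\<Sum>i=1..n. l i * (h i - e))" using pos by simp
  have "eventually (\<lambda>s. h i - e < g i s) F" if "i \<in> {1..n}" for i
  proof -
    have "ereal (h i - e) < ereal (h i)" using e by simp
    also note h[OF that]
    finally have "ereal (h i - e) < Liminf F (\<lambda>s. ereal (g i s))" .
    then have "eventually (\<lambda>s. ereal (h i - e) < ereal (g i s)) F"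
      by (rule less_LiminfD)
    then show ?thesis by simp
  qed
  then have "eventually (\<lambda>s. \<forall>i\<in>{1..n}. h i - e < g i s) F"
    by (intro eventually_ball_finite) auto
  then show ?thesis
  proof eventually_elim
    case (elim s)
    then have "(\<Sum>i=1..n. l i * (h i - e)) \<le> (\<Sum>i=1..n. l i * g i s)"
      by (intro sum_mono mult_left_mono l0) (auto intro: less_imp_le)
    with half show ?case by linarith
  qed
qed

text \<open>Negating g and h turns the upper limit into a lower one and reduces this to the positive
  case.\<close>

lemma eventually_weighted_sum_neg:
  fixes h :: "nat \<Rightarrow> real" and g :: "nat \<Rightarrow> 'a \<Rightarrow> real"
  assumes l: "l \<in> weights n"
    and h: "\<And>i. i \<in> {1..n} \<Longrightarrow> Limsup F (\<lambda>s. ereal (g i s)) \<le> ereal (h i)"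
    and neg: "(\<Sum>i=1..n. l i * h i) < 0"
  shows "eventually (\<lambda>s. (\<Sum>i=1..n. l i * g i s) < 0) F"
proof -
  have "eventually (\<lambda>s. 0 < (\<Sum>i=1..n. l i * - g i s)) F"
  proof (rule eventually_weighted_sum_pos[OF l, where h = "\<lambda>i. - h i"])
    fix i assume "i \<in> {1..n}"
    then have "- ereal (h i) \<le> - Limsup F (\<lambda>s. ereal (g i s))"
      using h by (simp only: ereal_minus_le_minus)
    also have "\<dots> = Liminf F (\<lambda>s. - ereal (g i s))"
      by (simp only: ereal_Liminf_uminus)
    finally show "ereal (- h i) \<le> Liminf F (\<lambda>s. ereal (- g i s))" by simp
  qed (use neg in \<open>simp add: sum_negf\<close>)
  then show ?thesis by (simp add: sum_negf)
qed

section \<open>Small scalings inside the interval\<close>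

lemma filterlim_mult_at_right_0:
  assumes "0 < (c::real)"
  shows "filterlim (\<lambda>t. t * c) (at_right 0) (at_right 0)"
  unfolding filterlim_at
proof
  show "eventually (\<lambda>t. t * c \<in> {0<..} \<and> t * c \<noteq> 0) (at_right 0)"
    using eventually_at_right_less[of "0::real"] by eventually_elim (use assms in auto)
  show "((\<lambda>t. t * c) \<longlongrightarrow> 0) (at_right 0)"
    by (rule tendsto_eq_intros refl)+ simp
qed

text \<open>By openness some point of I lies strictly to the left of x, and that point is already at
  least the infimum 0.\<close>

lemma interval_pos:
  assumes "open I" "bdd_below I" "Inf I = 0" "x \<in> I"
  shows "0 < (x::real)"
proof -
  obtain e where e: "0 < e" "ball x e \<subseteq> I"
    using assms(1,4) open_contains_ball by blast
  then have "x - e / 2 \<in> I" by (auto simp: dist_real_def subset_iff)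
  then have "0 \<le> x - e / 2" using cInf_lower[OF _ assms(2)] assms(3) by metis
  with e(1) show ?thesis by simp
qed

text \<open>Any positive t below a fixed point of I lies between that point and a point of I close
  to the infimum.\<close>

lemma eventually_in_interval:
  assumes "is_interval I" "I \<noteq> {}" "I \<subseteq> {0<..}" "Inf I = (0::real)"
  shows "eventually (\<lambda>t. t \<in> I) (at_right 0)"
proof -
  obtain a where a: "a \<in> I" using assms(2) by blast
  have "t \<in> I" if t: "0 < t" "t < a" for t
  proof -
    obtain b where "b \<in> I" "b < t"
      using cInf_lessD[OF assms(2), of t] assms(4) t(1) by auto
    then show ?thesis
      using mem_is_interval_1_I[OF assms(1) _ a, of b t] t by simp
  qed
  then show ?thesis using assms(3) a eventually_at_right_field 
    by (metis greaterThan_iff subset_iff)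
qed

lemma eventually_scaled_in_interval:
  assumes "is_interval I" "I \<noteq> {}" "I \<subseteq> {0<..}" "Inf I = (0::real)" "0 < c"
  shows "eventually (\<lambda>t. t * c \<in> I) (at_right 0)"
  by (rule eventually_compose_filterlim[OF eventually_in_interval[OF assms(1-4)]
        filterlim_mult_at_right_0[OF assms(5)]])

text \<open>At s = t * y the argument x i / y * s becomes t * x i, and all terms share one
  denominator. On I that denominator is positive, so both sides carry the sign of the deviation
  sum.\<close>

lemma normalization_sum:
  "(\<Sum>i=1..n. l i * (normalization E (x i / y * (t * y)) (t * y) / (t * y)))
     = dev_sum E n (\<lambda>i. t * x i) l (t * y) / (- diag_deriv E (t * y) * (t * y))"
  if "0 < (y::real)"
  using that
  by (simp add: dev_sum_def normalization_def sum_divide_distrib mult.commute flip: sum_negf)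

section \<open>Comparison of rescaled and homogeneous means\<close>

theorem theorem6p1:
  fixes I :: "real set" and E :: "real \<Rightarrow> real \<Rightarrow> real"
  assumes "is_interval I" "open I" "I \<noteq> {}"
    and "bdd_below I" "Inf I = 0"
    and "semideviation I E" "normalizable I E"
    and finite_h: "\<And>x. 0 < x \<Longrightarrow>
          - \<infinity> < lower_h E x \<and> lower_h E x \<le> upper_h E x \<and> upper_h E x < \<infinity>"
    and sign_h: "\<And>x. 0 < x \<Longrightarrow>
          sgn (lower_h E x) = ereal (sgn (x - 1)) \<and> sgn (upper_h E x) = ereal (sgn (x - 1))"
  shows "\<forall>n\<ge>1. \<forall>x l. (\<forall>i\<in>{1..n}. 0 < x i) \<and> l \<in> weights n \<longrightarrow>
           ereal (hom_lower_mean_w (\<lambda>u. real_of_ereal (lower_h E u)) n x l)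
             \<le> lower_hash (upper_mean_s I E) n x l \<and>
           upper_hash (lower_mean_s I E) n x l
             \<le> ereal (hom_upper_mean_w (\<lambda>u. real_of_ereal (upper_h E u)) n x l)"

proof (intro allI impI conjI; elim conjE)
  fix n :: nat and x l :: "nat \<Rightarrow> real"
  assume x': "\<forall>i\<in>{1..n}. 0 < x i" and l: "l \<in> weights n"
  note semi = \<open>semideviation I E\<close>
  have x: "0 < x i" if "i \<in> {1..n}" for i using x' that by blast
  have I_pos: "I \<subseteq> {0<..}"
    using interval_pos \<open>open I\<close> \<open>bdd_below I\<close> \<open>Inf I = 0\<close> by blast
  note scaled = eventually_scaled_in_interval[OF \<open>is_interval I\<close> \<open>I \<noteq> {}\<close> I_pos \<open>Inf I = 0\<close>]
  have scaled_x: "eventually (\<lambda>t. \<forall>i\<in>{1..n}. t * x i \<in> I) (at_right 0)"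
    by (intro eventually_ball_finite ballI scaled x) auto
  have diag: "0 < - diag_deriv E z * z" if "z \<in> I" for z
    using \<open>normalizable I E\<close> I_pos that
    by (auto simp: normalizable_def mult_neg_pos)

  define lo where "lo = (\<lambda>u. real_of_ereal (lower_h E u))"
  define hi where "hi = (\<lambda>u. real_of_ereal (upper_h E u))"
  \<comment> \<open>\<open>real_of_ereal\<close> maps both infinities to 0; finiteness of the limits
    ensures that nothing is lost.\<close>
  have lo: "ereal (lo u) = lower_h E u" and hi: "ereal (hi u) = upper_h E u" if "0 < u" for u
    using finite_h[OF that] unfolding lo_def hi_def
    by (cases "lower_h E u"; cases "upper_h E u"; simp)+
  have sgn_eq: "sgn (r::real) = s" if "sgn (ereal r) = ereal s" for r s
    using that by (auto simp: sgn_if zero_ereal_def one_ereal_def split: if_splits)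
  have semi_lo: "semideviation {0<..} (hom_dev lo)"
    by (rule semideviation_hom_dev) (metis lo sgn_eq sign_h)
  have semi_hi: "semideviation {0<..} (hom_dev hi)"
    by (rule semideviation_hom_dev) (metis hi sgn_eq sign_h)

  \<comment> \<open>Lower estimate\<close>
  show "ereal (hom_lower_mean_w (\<lambda>u. real_of_ereal (lower_h E u)) n x l)
          \<le> lower_hash (upper_mean_s I E) n x l"
  proof (fold lo_def, rule dense_le)
    have below: "ereal y \<le> lower_hash (upper_mean_s I E) n x l"
      if y: "0 < y" and pos: "0 < dev_sum (hom_dev lo) n x l y" for y
    proof -
      have "eventually (\<lambda>s. 0 < (\<Sum>i=1..n. l i * (normalization E (x i / y * s) s / s))) (at_right 0)"
      proof (rule eventually_weighted_sum_pos[OF l, where h = "\<lambda>i. lo (x i / y)"])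
        show "ereal (lo (x i / y)) \<le> Liminf (at_right 0) (\<lambda>s. ereal (normalization E (x i / y * s) s / s))"
          if "i \<in> {1..n}" for i
          using lo[of "x i / y"] x[OF that] y by (simp add: lower_h_def)
      qed (use pos in \<open>simp add: dev_sum_def hom_dev_def\<close>)
      from eventually_compose_filterlim[OF this filterlim_mult_at_right_0[OF y]]
        scaled[OF y] scaled_x eventually_at_right_less[of "0::real"]
      have "eventually (\<lambda>t. ereal y \<le> ereal (1 / t * upper_mean_s I E n (\<lambda>i. t * x i) l)) (at_right 0)"
      proof eventually_elim
        case (elim t)
        have "0 < dev_sum E n (\<lambda>i. t * x i) l (t * y)"
          using elim(1) diag[OF elim(2)]
          unfolding normalization_sum[OF y] by (simp only: zero_less_divide_iff) auto
        \<comment> \<open>A real supremum bounds its elements only if the set is bounded above; this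
          is where all t * x i must lie in I.\<close>
        moreover have "bdd_above {z \<in> I. 0 < dev_sum E n (\<lambda>i. t * x i) l z}"
          by (rule bdd_above_mono[OF bdd_above_dev_sum_nonneg[OF semi l, of "\<lambda>i. t * x i"]])
            (use elim(3) in auto)
        ultimately have "t * y \<le> upper_mean_s I E n (\<lambda>i. t * x i) l"
          unfolding upper_mean_s_def using elim(2) by (intro cSup_upper) auto
        then show ?case using elim(4) by (simp add: field_simps)
      qed
      then show ?thesis unfolding lower_hash_def by (rule Liminf_bounded)
    qed
    fix z :: ereal
    assume z: "z < ereal (hom_lower_mean_w lo n x l)"
    obtain y0 where y0: "0 < y0" "0 < dev_sum (hom_dev lo) n x l y0"
      using hom_dev_sum_pos_witness[OF semi_lo l, of x] x by blast
    show "z \<le> lower_hash (upper_mean_s I E) n x l"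
    \<comment> \<open>A nonpositive z is not a point of the homogeneous domain, so it is compared
      with the positive witness y0 instead.\<close>
    proof (cases "z \<le> 0")
      case True
      also have "0 \<le> ereal y0" using y0(1) by simp
      also note below[OF y0]
      finally show ?thesis .
    next
      case False
      with z obtain y where y: "z = ereal y" "0 < y" "y < hom_lower_mean_w lo n x l"
        by (cases z) auto
      have bdd: "bdd_below {y \<in> {0<..}. dev_sum (hom_dev lo) n x l y \<le> 0}"
        by (rule bdd_belowI[of _ 0]) auto
      \<comment> \<open>Otherwise y would belong to the set whose infimum is the homogeneous lower
        mean, although it lies below that mean.\<close>
      have "0 < dev_sum (hom_dev lo) n x l y"
      proof (rule ccontr)
        assume "\<not> 0 < dev_sum (hom_dev lo) n x l y"
        then have "hom_lower_mean_w lo n x l \<le> y"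
          unfolding hom_lower_mean_w_def lower_mean_w_def
          using y(2) by (intro cInf_lower bdd) auto
        with y(3) show False by simp
      qed
      with y below show ?thesis by simp
    qed
  qed

  \<comment> \<open>Upper estimate\<close>
  show "upper_hash (lower_mean_s I E) n x l
          \<le> ereal (hom_upper_mean_w (\<lambda>u. real_of_ereal (upper_h E u)) n x l)"
  proof (fold hi_def, rule dense_ge)
    have above: "upper_hash (lower_mean_s I E) n x l \<le> ereal y"
      if y: "0 < y" and neg: "dev_sum (hom_dev hi) n x l y < 0" for y
    proof -
      have "eventually (\<lambda>s. (\<Sum>i=1..n. l i * (normalization E (x i / y * s) s / s)) < 0) (at_right 0)"
      proof (rule eventually_weighted_sum_neg[OF l, where h = "\<lambda>i. hi (x i / y)"])
        show "Limsup (at_right 0) (\<lambda>s. ereal (normalization E (x i / y * s) s / s)) \<le> ereal (hi (x i / y))"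
          if "i \<in> {1..n}" for i
          using hi[of "x i / y"] x[OF that] y by (simp add: upper_h_def)
      qed (use neg in \<open>simp add: dev_sum_def hom_dev_def\<close>)
      from eventually_compose_filterlim[OF this filterlim_mult_at_right_0[OF y]]
        scaled[OF y] eventually_at_right_less[of "0::real"]
      have "eventually (\<lambda>t. ereal (1 / t * lower_mean_s I E n (\<lambda>i. t * x i) l) \<le> ereal y) (at_right 0)"
      proof eventually_elim
        case (elim t)
        have "dev_sum E n (\<lambda>i. t * x i) l (t * y) < 0"
          using elim(1) diag[OF elim(2)]
          unfolding normalization_sum[OF y] by (simp only: divide_less_0_iff) auto
        then have "lower_mean_s I E n (\<lambda>i. t * x i) l \<le> t * y"
          unfolding lower_mean_s_def
          using elim(2) \<open>bdd_below I\<close> by (intro cInf_lower) (auto intro: bdd_below_mono)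
        then show ?case using elim(3) by (simp add: field_simps)
      qed
      then show ?thesis unfolding upper_hash_def by (rule Limsup_bounded)
    qed
    fix z :: ereal
    assume z: "ereal (hom_upper_mean_w hi n x l) < z"
    have bdd: "bdd_above {y \<in> {0<..}. dev_sum (hom_dev hi) n x l y \<ge> 0}"
      by (rule bdd_above_dev_sum_nonneg[OF semi_hi l]) (use x in auto)
    \<comment> \<open>In contrapositive form: every positive y above the mean has a negative sum, as
      \<open>above\<close> demands.\<close>
    have le_mean: "y \<le> hom_upper_mean_w hi n x l" if "0 < y" "0 \<le> dev_sum (hom_dev hi) n x l y" for y
      unfolding hom_upper_mean_w_def upper_mean_w_def using that by (intro cSup_upper bdd) auto
    obtain y0 where "0 < y0" "0 < dev_sum (hom_dev hi) n x l y0"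
      using hom_dev_sum_pos_witness[OF semi_hi l, of x] x by blast
    \<comment> \<open>Every z above the mean is therefore positive, so no separate case of
      nonpositive z arises here.\<close>
    then have "0 < hom_upper_mean_w hi n x l" using le_mean[of y0] by simp
    then show "upper_hash (lower_mean_s I E) n x l \<le> z"
      using z above le_mean by (cases z) (auto simp: not_le intro: leI, (metis less_trans not_le)+)
  qed
qed

end
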